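(* Fix $\alpha>0$. Let the divisor $X=\{(\lambda,m_\lambda)\}_{\lambda\in\Lambda}$ satisfy the condition $\lim_{|\lambda|\to\infty}m_\lambda=+\infty$. Then $X$ cannot be simultaneously interpolating and sampling for $\mathcal F^\infty_\alpha$.
   Context: For $\alpha>0$, $\mathcal F^\infty_\alpha$ is the Banach space of entire functions $f$ with $\|f\|_{\alpha,\infty}=\sup_{z\in\mathbb C}|f(z)|e^{-\frac{\alpha}{2}|z|^2}<\infty$. A divisor is $X=\{(\lambda,m_\lambda)\}_{\lambda\in\Lambda}$, where $\Lambda$ is a sequence of (distinct) points in $\mathbb C$ and $m_\lambda\in\{1,2,3,\dots\}$ is the multiplicity associated with $\lambda$. The condition $\lim_{|\lambda|\to\infty}m_\lambda=+\infty$ means: for every $M$ there is $R$ such that $m_\lambda>M$ for all $\lambda\in\Lambda$ with $|\lambda|>R$. Put $N^\infty_\lambda=\{f\in\mathcal F^\infty_\alpha: f(\lambda)=f'(\lambda)=\dots=f^{(m_\lambda-1)}(\lambda)=0\}$, and let $\|f\|_{\mathcal F^\infty_\alpha/N^\infty_\lambda}=\inf_{g\in N^\infty_\lambda}\|f-g\|_{\alpha,\infty}$ be the quotient norm. $X$ is called sampling for $\mathcal F^\infty_\alpha$ if there exists $L>0$ such that $\|f\|_{\alpha,\infty}\le L\sup_{\lambda\in\Lambda}\|f\|_{\mathcal F^\infty_\alpha/N^\infty_\lambda}$ for all $f\in\mathcal F^\infty_\alpha$. $X$ is called interpolating for $\mathcal F^\infty_\alpha$ if for every family $(f_\lambda)_{\lambda\in\Lambda}\subset\mathcal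 F^\infty_\alpha$ with $\sup_{\lambda\in\Lambda}\|f_\lambda\|_{\mathcal F^\infty_\alpha/N^\infty_\lambda}<\infty$ there exists $f\in\mathcal F^\infty_\alpha$ such that $f-f_\lambda\in N^\infty_\lambda$ for all $\lambda\in\Lambda$. *)

theory Defs
  imports "HOL-Analysis.Analysis"
begin

text \<open>Norms are valued in \<open>ennreal\<close>: they are defined for every function, finiteness is
  literally \<open>< \<infinity>\<close>, and the supremum over an empty index set is \<open>0\<close>.\<close>

definition fock_norm :: "real \<Rightarrow> (complex \<Rightarrow> complex) \<Rightarrow> ennreal" where
  "fock_norm \<alpha> f = (SUP z. ennreal (norm (f z) * exp (- (\<alpha> / 2) * (norm z)\<^sup>2)))"

definition fock_space :: "real \<Rightarrow> (complex \<Rightarrow> complex) set" where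
  "fock_space \<alpha> = {f. f holomorphic_on UNIV \<and> fock_norm \<alpha> f < \<infinity>}"

text \<open>A sequence of distinct points is encoded by its countable set \<open>\<Lambda>\<close> of terms, and the
  multiplicities by a function of which only the values on \<open>\<Lambda>\<close> matter.  Finite \<open>\<Lambda>\<close> are
  allowed.\<close>

definition divisor :: "complex set \<Rightarrow> (complex \<Rightarrow> nat) \<Rightarrow> bool" where
  "divisor \<Lambda> m \<longleftrightarrow> countable \<Lambda> \<and> (\<forall>w\<in>\<Lambda>. 1 \<le> m w)"

definition multiplicities_tend_to_infinity :: "complex set \<Rightarrow> (complex \<Rightarrow> nat) \<Rightarrow> bool" where
  "multiplicities_tend_to_infinity \<Lambda> m \<longleftrightarrow>
     (\<forall>M. \<exists>R::real. \<forall>w\<in>\<Lambda>. R < norm w \<longrightarrow> M < m w)"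

definition vanishing_space :: "real \<Rightarrow> complex \<Rightarrow> nat \<Rightarrow> (complex \<Rightarrow> complex) set" where
  "vanishing_space \<alpha> w n = {f \<in> fock_space \<alpha>. \<forall>k<n. (deriv ^^ k) f w = 0}"

definition quotient_norm :: "real \<Rightarrow> complex \<Rightarrow> nat \<Rightarrow> (complex \<Rightarrow> complex) \<Rightarrow> ennreal" where
  "quotient_norm \<alpha> w n f = (INF g\<in>vanishing_space \<alpha> w n. fock_norm \<alpha> (\<lambda>z. f z - g z))"

definition sampling :: "real \<Rightarrow> complex set \<Rightarrow> (complex \<Rightarrow> nat) \<Rightarrow> bool" where
  "sampling \<alpha> \<Lambda> m \<longleftrightarrow>
     (\<exists>L::real. L > 0 \<and>
        (\<forall>f\<in>fock_space \<alpha>.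
           fock_norm \<alpha> f \<le> ennreal L * (SUP w\<in>\<Lambda>. quotient_norm \<alpha> w (m w) f)))"

definition interpolating :: "real \<Rightarrow> complex set \<Rightarrow> (complex \<Rightarrow> nat) \<Rightarrow> bool" where
  "interpolating \<alpha> \<Lambda> m \<longleftrightarrow>
     (\<forall>F :: complex \<Rightarrow> complex \<Rightarrow> complex.
        (\<forall>w\<in>\<Lambda>. F w \<in> fock_space \<alpha>) \<and>
        (SUP w\<in>\<Lambda>. quotient_norm \<alpha> w (m w) (F w)) < \<infinity> \<longrightarrow>
        (\<exists>f\<in>fock_space \<alpha>. \<forall>w\<in>\<Lambda>. (\<lambda>z. f z - F w z) \<in> vanishing_space \<alpha> w (m w)))"

end

theory Submission
  imports Defs "HOL-Complex_Analysis.Complex_Analysis"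
begin

text \<open>Put \<open>\<rho> w = sqrt (m w / \<alpha>)\<close> and suppose the divisor is both sampling and interpolating. Test
  functions are the normalized kernels \<open>k\<close>, which have norm 1 and peak at a given point \<open>z\<close>.
  Truncating the Taylor expansion of \<open>k\<close> about \<open>w\<close> shows that its quotient norm at \<open>w\<close> is small
  when \<open>z\<close> lies far outside the disc of radius \<open>\<rho> w\<close>; sampling therefore forces the
  discs of radius \<open>\<rho> w + C\<close> to cover the plane. Conversely, a bounded function with a zero of order
  \<open>m w\<close> at \<open>w\<close> is small deep inside the disc, by the maximum principle. The sampling
  inequality bounds a function interpolating \<open>k\<close> at one node and \<open>0\<close> at the others, so the
  open mapping theorem is not needed, and it follows that the discs of radius \<open>\<rho> w - C\<close> are
  disjoint. Far from the origin all discs involved are huge, and there is a point lying within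
  bounded distance of three of the disjoint discs. The directions to the three centres would have to
  be pairwise almost opposite, which is impossible.\<close>

section \<open>Plane geometry of almost tiling discs\<close>

text \<open>The squared norm of a sum of three unit vectors is 3 plus twice the sum of the pairwise
  inner products, so these cannot all lie below -1/2. Near equality in the triangle inequality would
  force exactly that.\<close>

lemma no_three_almost_opposite:
  fixes a b c :: "'a::real_inner"
  assumes D: "0 < D"
    and far: "4 * D < norm a" "4 * D < norm b" "4 * D < norm c"
    and opp: "norm a + norm b - D \<le> norm (a - b)" "norm b + norm c - D \<le> norm (b - c)"
      "norm a + norm c - D \<le> norm (a - c)"
  shows False
proof -
  \<comment> \<open>Squaring the third assumption leaves error terms \<open>2 * D * norm u\<close>
    and \<open>2 * D * norm v\<close>. The factor 4 in the lower bounds makes each smaller than half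
    of \<open>norm u * norm v\<close>.\<close>
  have cos_small: "inner (sgn u) (sgn v) < - 1 / 2"
    if "4 * D < norm u" "4 * D < norm v" "norm u + norm v - D \<le> norm (u - v)" for u v :: 'a
  proof -
    have pos: "0 < norm u" "0 < norm v" using that D by linarith+
    have "(norm u + norm v - D)\<^sup>2 \<le> (norm (u - v))\<^sup>2"
      using that D by (intro power_mono) linarith+
    also have "\<dots> = (norm u)\<^sup>2 + (norm v)\<^sup>2 - 2 * inner u v"
      by (simp add: power2_norm_eq_inner inner_diff inner_commute)
    finally have "2 * inner u v \<le> - 2 * (norm u * norm v) + 2 * (D * norm u) + 2 * (D * norm v) - D\<^sup>2"
      by (simp add: power2_eq_square algebra_simps)
    moreover have "4 * (D * norm u) < norm u * norm v" "4 * (D * norm v) < norm u * norm v"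
      using mult_strict_right_mono[OF that(2) pos(1)] mult_strict_right_mono[OF that(1) pos(2)]
      by (simp_all add: mult_ac)
    ultimately have "2 * inner u v < - (norm u * norm v)"
      using zero_le_power2[of D] by linarith
    moreover have "inner (sgn u) (sgn v) = inner u v / (norm u * norm v)"
      by (simp add: sgn_div_norm divide_simps)
    ultimately show ?thesis using pos by (simp only: pos_divide_less_eq mult_pos_pos)
  qed
  have "0 \<le> (norm (sgn a + sgn b + sgn c))\<^sup>2" by simp
  also have "\<dots> = (norm (sgn a))\<^sup>2 + (norm (sgn b))\<^sup>2 + (norm (sgn c))\<^sup>2
      + 2 * (inner (sgn a) (sgn b) + inner (sgn b) (sgn c) + inner (sgn a) (sgn c))"
    by (simp add: power2_norm_eq_inner inner_add inner_commute)
  also have "\<dots> = 3 + 2 * (inner (sgn a) (sgn b) + inner (sgn b) (sgn c) + inner (sgn a) (sgn c))"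
    using D far by (auto simp: norm_sgn)
  finally have "- 3 / 2 \<le> inner (sgn a) (sgn b) + inner (sgn b) (sgn c) + inner (sgn a) (sgn c)"
    by simp
  also have "\<dots> < - 1 / 2 + - 1 / 2 + - 1 / 2"
    by (intro add_strict_mono cos_small far opp)
  finally show False by simp
qed

text \<open>The lens is contained in the disc whose diameter joins the two intersection points of the
  circles, so one of these points is almost as far from the origin as \<open>p\<close> is.\<close>

lemma circles_intersect_far:
  fixes a b p :: complex
  assumes p: "dist p a \<le> ra" "dist p b \<le> rb" and d: "ra \<le> dist a b" "rb \<le> dist a b" "a \<noteq> b"
  obtains z where "dist z a = ra" "dist z b = rb" "(norm p)\<^sup>2 \<le> 2 * (norm z)\<^sup>2"
proof -
  define d where "d = dist a b"
  define e where "e = (b - a) / of_real d"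
  \<comment> \<open>In the frame with origin \<open>a\<close> and unit vector \<open>e\<close>
    towards \<open>b\<close>, the common chord of the circles has abscissa \<open>x\<close> and
    half-length \<open>y\<close>. Since neither radius exceeds \<open>d\<close>, the chord crosses
    the segment between the centres.\<close>
  define x where "x = (d\<^sup>2 + ra\<^sup>2 - rb\<^sup>2) / (2 * d)"
  define y where "y = sqrt (ra\<^sup>2 - x\<^sup>2)"
  define q where "q = (p - a) / e"
  have d0: "0 < d" and dra: "ra \<le> d" "rb \<le> d" using assms by (auto simp: d_def)
  have r0: "0 \<le> ra" "0 \<le> rb" using p zero_le_dist order_trans by blast+
  have tri: "d \<le> ra + rb" using p dist_triangle[of a b p] by (simp add: d_def dist_commute)
  have e1: "norm e = 1" using d0 by (simp add: e_def norm_divide d_def dist_norm norm_minus_commute)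
  hence e0: "e \<noteq> 0" by auto
  have b: "b = a + of_real d * e" using d0 by (simp add: e_def)
  have pq: "p = a + q * e" using e0 by (simp add: q_def)
  have x2: "2 * d * x = d\<^sup>2 + ra\<^sup>2 - rb\<^sup>2" using d0 by (simp add: x_def)
  have "0 \<le> 2 * d * x" using power_mono[OF dra(2) r0(2), of 2] zero_le_power2[of ra] x2 by linarith
  hence x0: "0 \<le> x" using d0 by (simp add: zero_le_mult_iff)
  have "2 * d * x \<le> 2 * d\<^sup>2"
    using power_mono[OF dra(1) r0(1), of 2] zero_le_power2[of rb] x2 by linarith
  hence xd: "x \<le> d" using d0 by (simp add: power2_eq_square)
  have "(d - ra)\<^sup>2 \<le> rb\<^sup>2" using tri dra by (intro power_mono) auto
  hence "2 * d * x \<le> 2 * d * ra" using x2 by (simp add: power2_eq_square algebra_simps)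
  hence xra: "x \<le> ra" using d0 by simp
  have y2: "y\<^sup>2 = ra\<^sup>2 - x\<^sup>2" using power_mono[OF xra x0, of 2] by (simp add: y_def)
  have y0: "0 \<le> y" using power_mono[OF xra x0, of 2] by (simp add: y_def)
  have on_circles: "dist (a + Complex x t * e) a = ra" "dist (a + Complex x t * e) b = rb"
    if "t\<^sup>2 = y\<^sup>2" for t
  proof -
    have "x\<^sup>2 + t\<^sup>2 = ra\<^sup>2" using that y2 by simp
    thus "dist (a + Complex x t * e) a = ra"
      using r0 by (simp add: dist_norm norm_mult e1 complex_norm)
    have "(a + Complex x t * e) - b = Complex (x - d) t * e"
      by (simp add: b algebra_simps complex_of_real_def complex_eq_iff)
    moreover have "(x - d)\<^sup>2 + t\<^sup>2 = rb\<^sup>2" using that y2 x2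
      by (simp add: power2_eq_square algebra_simps)
    ultimately show "dist (a + Complex x t * e) b = rb"
      using r0 by (simp add: dist_norm norm_mult e1 complex_norm)
  qed
  define c where "c = a + of_real x * e"
  have z1: "a + Complex x y * e = c + Complex 0 y * e" and z2: "a + Complex x (-y) * e = c - Complex 0 y * e"
    by (simp_all add: c_def algebra_simps complex_eq_iff)
  have "norm q \<le> ra" using p(1) by (simp add: pq dist_norm norm_mult e1)
  hence qa: "(Re q)\<^sup>2 + (Im q)\<^sup>2 \<le> ra\<^sup>2"
    using power_mono[of "norm q" ra 2] by (simp add: cmod_power2)
  have "p - b = (q - of_real d) * e" by (simp add: pq b algebra_simps)
  hence "norm (q - of_real d) \<le> rb" using p(2) by (simp add: dist_norm norm_mult e1)
  hence qb: "(Re q - d)\<^sup>2 + (Im q)\<^sup>2 \<le> rb\<^sup>2"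
    using power_mono[of "norm (q - of_real d)" rb 2] by (simp add: cmod_power2)
  \<comment> \<open>Beyond the chord as seen from \<open>a\<close> this follows from the disc about
    \<open>a\<close> and \<open>0 \<le> x\<close>; before it, from the disc about \<open>b\<close>
    and \<open>x \<le> d\<close>.\<close>
  have "(Re q - x)\<^sup>2 + (Im q)\<^sup>2 \<le> y\<^sup>2"
  proof (cases "x \<le> Re q")
    case True
    hence "x * x \<le> x * Re q" using x0 by (intro mult_left_mono)
    thus ?thesis using qa y2 by (simp add: power2_eq_square algebra_simps)
  next
    case False
    hence "Re q * (d - x) \<le> x * (d - x)" using xd by (intro mult_right_mono) auto
    thus ?thesis using qb y2 x2 by (simp add: power2_eq_square algebra_simps)
  qed
  hence "(norm (q - of_real x))\<^sup>2 \<le> y\<^sup>2" by (simp add: cmod_power2)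
  hence "norm (q - of_real x) \<le> y" using y0 power2_le_imp_le by blast
  moreover have "p - c = (q - of_real x) * e" by (simp add: pq c_def algebra_simps)
  ultimately have "norm (p - c) \<le> y" by (simp add: norm_mult e1)
  hence "norm p \<le> norm c + y" using norm_triangle_sub[of p c] by linarith
  hence "(norm p)\<^sup>2 \<le> (norm c + y)\<^sup>2" by (intro power_mono) auto
  also have "\<dots> \<le> 2 * (norm c)\<^sup>2 + 2 * y\<^sup>2"
    using sum_squares_bound[of "norm c" y] by (simp add: power2_eq_square algebra_simps)
  \<comment> \<open>Parallelogram law: \<open>c\<close> is the midpoint of the chord, so the
    summands belong to the two intersection points and one of them is at least half of the
    total.\<close>
  also have "\<dots> = (norm (c + Complex 0 y * e))\<^sup>2 + (norm (c - Complex 0 y * e))\<^sup>2"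
  proof -
    have "(norm (Complex 0 y * e))\<^sup>2 = y\<^sup>2" by (simp add: norm_mult e1 cmod_power2)
    thus ?thesis by (simp add: power2_norm_eq_inner inner_add inner_diff inner_commute)
  qed
  finally have "(norm p)\<^sup>2 \<le> 2 * (norm (a + Complex x y * e))\<^sup>2 \<or>
      (norm p)\<^sup>2 \<le> 2 * (norm (a + Complex x (-y) * e))\<^sup>2"
    unfolding z1 z2 by linarith
  thus thesis using on_circles[of y] on_circles[of "-y"] that by auto
qed

text \<open>Moving out along the real axis leads to the rim of an enlarged disc, then to a point on
  the rims of two, which a third disc must cover. Separation makes the directions to the three
  centres almost opposite in pairs.\<close>

lemma no_almost_tiling_by_growing_discs:
  fixes \<Lambda> :: "complex set" and \<rho> :: "complex \<Rightarrow> real"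
  assumes C: "0 \<le> C"
    and cover: "\<And>z. \<exists>w\<in>\<Lambda>. dist z w \<le> \<rho> w + C"
    and sep: "\<And>v w. v \<in> \<Lambda> \<Longrightarrow> w \<in> \<Lambda> \<Longrightarrow> v \<noteq> w \<Longrightarrow> C \<le> \<rho> v \<Longrightarrow> C \<le> \<rho> w \<Longrightarrow>
       \<rho> v + \<rho> w - 2 * C \<le> dist v w"
    and grow: "\<And>T. \<exists>R. \<forall>w\<in>\<Lambda>. R < norm w \<longrightarrow> T \<le> \<rho> w"
  shows False
proof -
  \<comment> \<open>At the final point \<open>z\<close> the distances to two centres exceed the sum
    of their radii by at most \<open>2 * C + 2\<close>, and separation loses another
    \<open>2 * C\<close>. The value of \<open>T\<close> leaves every centre farther than
    \<open>4 * D\<close> from \<open>z\<close>, also the third, for which only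
    \<open>\<rho> c - 3 * C - 1\<close> is available.\<close>
  define D where "D = 4 * C + 2"
  define T where "T = 5 * D"
  obtain R0 where R0: "\<And>w. w \<in> \<Lambda> \<Longrightarrow> R0 < norm w \<Longrightarrow> T \<le> \<rho> w" using grow by blast
  \<comment> \<open>A centre of norm at most \<open>R0\<close> whose enlarged disc reaches norm
    \<open>R\<close> has radius at least \<open>T\<close> for that very reason.\<close>
  define R where "R = \<bar>R0\<bar> + T + C + 1"
  have D0: "0 < D" "0 \<le> T" using C by (auto simp: D_def T_def)
  have large: "T \<le> \<rho> w" if "w \<in> \<Lambda>" "R \<le> norm z" "dist z w \<le> \<rho> w + C + 1" for w z
  proof (cases "R0 < norm w")
    case False
    have "norm z \<le> norm w + dist z w" unfolding dist_norm by (rule norm_triangle_sub)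
    thus ?thesis using False that by (simp add: R_def)
  qed (use R0 that in auto)
  have R1: "1 \<le> R" using C D0 by (simp add: R_def)
  define f where "f t = complex_of_real t" for t
  obtain a where a: "a \<in> \<Lambda>" "dist (f (2 * R)) a \<le> \<rho> a + C" using cover by blast
  \<comment> \<open>Far enough along the axis to lie outside the enlarged disc of \<open>a\<close>,
    so that the intermediate value theorem yields a point on its rim.\<close>
  define s where "s = 2 * R + norm a + \<bar>\<rho> a\<bar> + C + 1"
  have s: "2 * R \<le> s" using C by (simp add: s_def)
  have "norm (f s) \<le> norm a + dist (f s) a" unfolding dist_norm by (rule norm_triangle_sub)
  moreover have "norm (f s) = s" using s R1 by (simp add: f_def)
  ultimately have "\<rho> a + C + 1 \<le> dist (f s) a" using R1 by (simp add: s_def)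
  moreover have "continuous_on {2 * R..s} (\<lambda>t. dist (f t) a)"
    unfolding f_def by (intro continuous_intros)
  ultimately obtain t where t: "2 * R \<le> t" "dist (f t) a = \<rho> a + C + 1"
    using IVT'[of "\<lambda>t. dist (f t) a" "2 * R" "\<rho> a + C + 1" s] a s by auto
  have ft: "2 * R \<le> norm (f t)" using t by (simp add: f_def)
  obtain b where b: "b \<in> \<Lambda>" "dist (f t) b \<le> \<rho> b + C" using cover by blast
  \<comment> \<open>The extra 1 in the enlarged radius puts the rim of \<open>a\<close> outside its
    covering disc, so the covering disc must have another centre.\<close>
  have ab: "a \<noteq> b" using b t by auto
  have Ta: "T \<le> \<rho> a" using large[of a "f t"] a t ft R1 by auto
  have Tb: "T \<le> \<rho> b" using large[of b "f t"] b ft R1 by auto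
  have dab: "\<rho> a + \<rho> b - 2 * C \<le> dist a b"
    using sep[OF a(1) b(1) ab] Ta Tb C by (auto simp: T_def D_def)
  \<comment> \<open>Passing to an intersection point may lose a factor \<open>sqrt 2\<close> in the
    norm; starting at \<open>2 * R\<close> absorbs it and keeps \<open>norm z\<close> at least
    \<open>R\<close>.\<close>
  obtain z where z: "dist z a = \<rho> a + C + 1" "dist z b = \<rho> b + C + 1"
      "(norm (f t))\<^sup>2 \<le> 2 * (norm z)\<^sup>2"
    using circles_intersect_far[of "f t" a "\<rho> a + C + 1" b "\<rho> b + C + 1"] t b dab Ta Tb C ab
    by (auto simp: T_def D_def)
  have "(2 * norm z)\<^sup>2 = 4 * (norm z)\<^sup>2" by (simp add: power_mult_distrib)
  hence "(norm (f t))\<^sup>2 \<le> (2 * norm z)\<^sup>2"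
    using z(3) zero_le_power2[of "norm z"] by linarith
  hence "norm (f t) \<le> 2 * norm z" by (rule power2_le_imp_le) simp
  hence Rz: "R \<le> norm z" using ft by simp
  obtain c where c: "c \<in> \<Lambda>" "dist z c \<le> \<rho> c + C" using cover by blast
  have ne: "a \<noteq> c" "b \<noteq> c" using c z by auto
  have Tc: "T \<le> \<rho> c" using large[of c z] c Rz by auto
  have dac: "\<rho> a + \<rho> c - 2 * C \<le> dist a c" and dbc: "\<rho> b + \<rho> c - 2 * C \<le> dist b c"
    using sep[OF a(1) c(1) ne(1)] sep[OF b(1) c(1) ne(2)] Ta Tb Tc C by (auto simp: T_def D_def)
  have cz: "\<rho> c - 3 * C - 1 \<le> dist z c"
    using dac dist_triangle[of a c z] z(1) by (simp add: dist_commute)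
  show False
  proof (rule no_three_almost_opposite[OF D0(1), of "a - z" "b - z" "c - z"])
    show "4 * D < norm (a - z)" "4 * D < norm (b - z)" "4 * D < norm (c - z)"
      using z cz Ta Tb Tc C by (auto simp: T_def D_def dist_norm norm_minus_commute)
  next
    show "norm (a - z) + norm (b - z) - D \<le> norm ((a - z) - (b - z))"
      "norm (b - z) + norm (c - z) - D \<le> norm ((b - z) - (c - z))"
      "norm (a - z) + norm (c - z) - D \<le> norm ((a - z) - (c - z))"
      using z c dab dac dbc C by (auto simp: D_def dist_norm norm_minus_commute)
  qed
qed

section \<open>Zeros of entire functions and the truncated exponential\<close>

text \<open>Differentiation lowers the power of \<open>z - w\<close> by one and leaves an entire
  cofactor, so the induction on \<open>k\<close> needs arbitrary \<open>n\<close> and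
  \<open>q\<close>.\<close>

lemma higher_deriv_power_mult_zero:
  fixes q :: "complex \<Rightarrow> complex"
  assumes "q holomorphic_on UNIV" "k < n"
  shows "(deriv ^^ k) (\<lambda>z. (z - w) ^ n * q z) w = 0"
  using assms
proof (induction k arbitrary: n q)
  case 0
  then show ?case by simp
next
  case (Suc k)
  then obtain n' where n': "n = Suc n'" "k < n'" by (cases n) auto
  have "deriv (\<lambda>z. (z - w) ^ n * q z) = (\<lambda>z. (z - w) ^ n' * (of_nat n * q z + (z - w) * deriv q z))"
  proof
    fix z
    have "(q has_field_derivative deriv q z) (at z)"
      using Suc.prems(1) holomorphic_derivI by blast
    hence "((\<lambda>z. (z - w) ^ n * q z) has_field_derivative
        (z - w) ^ n' * (of_nat n * q z + (z - w) * deriv q z)) (at z)"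
      unfolding n'(1)
      by (intro DERIV_cong[OF DERIV_mult[OF DERIV_power[OF DERIV_diff[OF DERIV_ident DERIV_const]]]])
        (auto simp: algebra_simps simp del: of_nat_Suc)
    thus "deriv (\<lambda>z. (z - w) ^ n * q z) z = (z - w) ^ n' * (of_nat n * q z + (z - w) * deriv q z)"
      by (rule DERIV_imp_deriv)
  qed
  moreover have "(\<lambda>z. of_nat n * q z + (z - w) * deriv q z) holomorphic_on UNIV"
    using Suc.prems(1) by (intro holomorphic_intros) auto
  ultimately show ?case using Suc.IH n' by (simp add: funpow_Suc_right del: funpow.simps)
qed

text \<open>The cofactor is the Taylor series about \<open>w\<close> with its first \<open>n\<close>
  coefficients, all zero, shifted away; it converges everywhere.\<close>

lemma entire_factor_zero:
  fixes f :: "complex \<Rightarrow> complex"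
  assumes f: "f holomorphic_on UNIV" and van: "\<And>k. k < n \<Longrightarrow> (deriv ^^ k) f w = 0"
  obtains q where "q holomorphic_on UNIV" "\<And>z. f z = (z - w) ^ n * q z"
proof -
  define a where "a k = (deriv ^^ k) f w / fact k" for k
  have sums: "(\<lambda>k. a k * (z - w) ^ k) sums f z" for z
    unfolding a_def
    by (rule holomorphic_power_series[of f w "dist w z + 1"])
      (auto intro: holomorphic_on_subset[OF f])
  have shifted: "(\<lambda>k. a (k + n) * (z - w) ^ (k + n)) sums f z" for z
    using sums[of z] sums_iff_shift[of "\<lambda>k. a k * (z - w) ^ k" n "f z"] van by (simp add: a_def)
  define q where "q z = (\<Sum>k. a (k + n) * (z - w) ^ k)" for z
  \<comment> \<open>Away from \<open>w\<close> the series for \<open>f\<close> is divided by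
    \<open>(z - w) ^ n\<close>; at \<open>w\<close> only the constant term survives.\<close>
  have q: "(\<lambda>k. a (k + n) * (z - w) ^ k) sums q z" for z
  proof (cases "z = w")
    case True
    then show ?thesis
      unfolding q_def by (intro summable_sums summable_finite[of "{0}"]) auto
  next
    case False
    have "(\<lambda>k. (a (k + n) * (z - w) ^ (k + n)) / (z - w) ^ n) sums (f z / (z - w) ^ n)"
      by (intro sums_divide shifted)
    hence "(\<lambda>k. a (k + n) * (z - w) ^ k) sums (f z / (z - w) ^ n)"
      using False by (simp add: power_add)
    thus ?thesis unfolding q_def by (intro summable_sums) (auto simp: summable_def)
  qed
  have "f z = (z - w) ^ n * q z" for z
  proof -
    have "(\<lambda>k. (z - w) ^ n * (a (k + n) * (z - w) ^ k)) sums ((z - w) ^ n * q z)"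
      by (intro sums_mult q)
    hence "(\<lambda>k. a (k + n) * (z - w) ^ (k + n)) sums ((z - w) ^ n * q z)"
      by (simp add: power_add mult_ac)
    thus ?thesis using shifted sums_unique2 by blast
  qed
  moreover have "q holomorphic_on UNIV"
  proof -
    have "q holomorphic_on ball w r" for r
      by (rule power_series_holomorphic[of w r "\<lambda>k. a (k + n)"]) (rule q)
    hence "q field_differentiable at z" for z
      using holomorphic_on_imp_differentiable_at[of q "ball w (dist w z + 1)" z] by auto
    thus ?thesis by (simp add: holomorphic_on_def field_differentiable_at_within)
  qed
  ultimately show thesis using that by blast
qed

text \<open>The derivative of each Taylor remainder of \<open>exp\<close> is the preceding
  remainder, and all but the zeroth vanish at 0.\<close>

lemma exp_remainder_factor:
  obtains q :: "complex \<Rightarrow> complex" where "q holomorphic_on UNIV"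
    "\<And>z. exp z - (\<Sum>k<n. z ^ k / fact k) = z ^ n * q z"
proof -
  define r where "r n z = exp z - (\<Sum>k<n. z ^ k / fact k)" for n and z :: complex
  have dr: "deriv (r (Suc n)) = r n" for n
  proof
    fix z :: complex
    have "((\<lambda>z. z ^ Suc k / fact (Suc k)) has_field_derivative z ^ k / fact k) (at z)" for k
      by (rule DERIV_cong[OF DERIV_cdivide[OF DERIV_power[OF DERIV_ident]]])
        (simp add: divide_simps del: of_nat_Suc)
    hence "((\<lambda>z. \<Sum>k<n. z ^ Suc k / fact (Suc k)) has_field_derivative (\<Sum>k<n. z ^ k / fact k)) (at z)"
      by (intro DERIV_sum)
    from DERIV_add[OF DERIV_const[of 1] this]
    have "((\<lambda>z. \<Sum>k<Suc n. z ^ k / fact k) has_field_derivative (\<Sum>k<n. z ^ k / fact k)) (at z)"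
      unfolding sum.lessThan_Suc_shift
      by simp
    hence "(r (Suc n) has_field_derivative r n z) (at z)"
      unfolding r_def[abs_def] by (intro DERIV_diff DERIV_exp)
    thus "deriv (r (Suc n)) z = r n z" by (rule DERIV_imp_deriv)
  qed
  have "(deriv ^^ k) (r n) 0 = 0" if "k < n" for k n
    using that
  proof (induction k arbitrary: n)
    case 0
    then show ?case by (cases n) (auto simp: r_def sum.lessThan_Suc_shift simp del: sum.lessThan_Suc)
  next
    case (Suc k)
    then show ?case by (cases n) (auto simp: funpow_Suc_right dr simp del: funpow.simps)
  qed
  moreover have "r n holomorphic_on UNIV" unfolding r_def[abs_def] by (intro holomorphic_intros) auto
  ultimately show thesis
    using entire_factor_zero[of "r n" n 0] that by (auto simp: r_def)
qed

text \<open>Each term of index \<open>k < n\<close> may be multiplied by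
  \<open>t ^ k / t ^ n\<close>, which is at least 1; completing the sum then gives an exponential.
  The free parameter \<open>t\<close> is optimized in the application.\<close>

lemma norm_truncated_exp_le:
  fixes v :: complex
  assumes t: "0 < t" "t \<le> 1"
  shows "norm (\<Sum>k<n. v ^ k / fact k) \<le> exp (norm v * t) / t ^ n"
proof -
  have "norm (\<Sum>k<n. v ^ k / fact k) \<le> (\<Sum>k<n. norm v ^ k / fact k)"
    by (rule order_trans[OF norm_sum]) (simp add: norm_divide norm_power)
  also have "\<dots> \<le> (\<Sum>k<n. (norm v * t) ^ k / fact k / t ^ n)"
  proof (rule sum_mono)
    fix k assume "k \<in> {..<n}"
    hence "t ^ n \<le> t ^ k" using t by (intro power_decreasing) auto
    hence "norm v ^ k / fact k * t ^ n \<le> norm v ^ k / fact k * t ^ k" by (intro mult_left_mono) auto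
    thus "norm v ^ k / fact k \<le> (norm v * t) ^ k / fact k / t ^ n"
      using t by (simp add: field_simps power_mult_distrib)
  qed
  also have "\<dots> = (\<Sum>k<n. (norm v * t) ^ k / fact k) / t ^ n" by (simp add: sum_divide_distrib)
  also have "(\<Sum>k<n. (norm v * t) ^ k / fact k) \<le> exp (norm v * t)"
  proof -
    have "(\<lambda>k. (norm v * t) ^ k / fact k) sums exp (norm v * t)"
      using exp_converges[of "norm v * t"] by (simp add: field_simps)
    hence "summable (\<lambda>k. (norm v * t) ^ k / fact k)"
      "exp (norm v * t) = (\<Sum>k. (norm v * t) ^ k / fact k)" by (auto simp: sums_iff)
    thus ?thesis using sum_le_suminf[of "\<lambda>k. (norm v * t) ^ k / fact k" "{..<n}"] t by simp
  qed
  finally show ?thesis using t by (simp add: divide_right_mono)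
qed

text \<open>The choice \<open>n = \<alpha> * r\<^sup>2\<close> puts the maximum of
  \<open>s ^ n * exp (- (\<alpha> / 2) * s\<^sup>2)\<close> at \<open>s = r\<close>. The bound
  \<open>x \<le> exp (x - 1)\<close> at \<open>x = s / r\<close> gives Gaussian decay on both sides
  of it: outside the disc for kernels, inside for functions with zeros.\<close>

lemma weighted_power_le:
  fixes \<alpha> r s :: real
  assumes r: "0 < r" "real n = \<alpha> * r\<^sup>2" and s: "0 \<le> s"
  shows "(s / r) ^ n * exp (\<alpha> / 2 * (r\<^sup>2 - s\<^sup>2)) \<le> exp (- (\<alpha> / 2) * (s - r)\<^sup>2)"
proof -
  have "s / r \<le> exp (s / r - 1)" using exp_ge_add_one_self[of "s / r - 1"] by simp
  hence "(s / r) ^ n \<le> exp (s / r - 1) ^ n" using r s by (intro power_mono) auto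
  also have "\<dots> = exp (real n * (s / r - 1))" by (simp add: exp_of_nat_mult)
  also have "real n * (s / r - 1) = \<alpha> * r * s - \<alpha> * r\<^sup>2"
    using r by (simp add: power2_eq_square field_simps)
  finally have "(s / r) ^ n * exp (\<alpha> / 2 * (r\<^sup>2 - s\<^sup>2)) \<le>
      exp (\<alpha> * r * s - \<alpha> * r\<^sup>2) * exp (\<alpha> / 2 * (r\<^sup>2 - s\<^sup>2))" by simp
  also have "\<dots> = exp (- (\<alpha> / 2) * (s - r)\<^sup>2)"
    unfolding exp_add[symmetric] by (simp add: power2_eq_square field_simps)
  finally show ?thesis .
qed

section \<open>Weighted norms and normalized kernels\<close>

lemma fock_norm_le:
  assumes "\<And>z. norm (f z) * exp (- (\<alpha> / 2) * (norm z)\<^sup>2) \<le> M"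
  shows "fock_norm \<alpha> f \<le> ennreal M"
  unfolding fock_norm_def by (intro SUP_least ennreal_leI assms)

lemma fock_normD:
  assumes "fock_norm \<alpha> f \<le> ennreal M" "0 \<le> M"
  shows "norm (f z) * exp (- (\<alpha> / 2) * (norm z)\<^sup>2) \<le> M"
proof -
  have "ennreal (norm (f z) * exp (- (\<alpha> / 2) * (norm z)\<^sup>2)) \<le> fock_norm \<alpha> f"
    unfolding fock_norm_def by (rule SUP_upper) simp
  thus ?thesis using assms by (meson ennreal_le_iff order_trans)
qed

lemma fock_spaceI:
  assumes "f holomorphic_on UNIV" "\<And>z. norm (f z) * exp (- (\<alpha> / 2) * (norm z)\<^sup>2) \<le> M"
  shows "f \<in> fock_space \<alpha>"
  using assms fock_norm_le[of f \<alpha> M] unfolding fock_space_def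
  by (auto intro: le_less_trans)

lemma vanishing_spaceI:
  assumes "q holomorphic_on UNIV" "\<And>z. f z = (z - w) ^ n * q z"
    and "\<And>z. norm (f z) * exp (- (\<alpha> / 2) * (norm z)\<^sup>2) \<le> M"
  shows "f \<in> vanishing_space \<alpha> w n"
proof -
  have f: "f = (\<lambda>z. (z - w) ^ n * q z)" using assms(2) by blast
  have "f holomorphic_on UNIV" unfolding f by (intro holomorphic_intros assms)
  thus ?thesis
    using assms fock_spaceI[of f \<alpha> M] higher_deriv_power_mult_zero[OF assms(1), of _ n w]
    unfolding vanishing_space_def by (auto simp flip: f)
qed

lemma zero_in_vanishing_space: "(\<lambda>z. 0) \<in> vanishing_space \<alpha> w n"
  by (rule vanishing_spaceI[of "\<lambda>z. 0" _ _ _ _ 0]) auto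

text \<open>The normalized reproducing kernel at \<open>z\<close> of the Hilbert Fock space with
  weight \<open>exp (- \<alpha> * (norm u)\<^sup>2)\<close>. Completing the square shows that its
  weighted modulus is a Gaussian centred at \<open>z\<close>.\<close>

definition fock_kernel :: "real \<Rightarrow> complex \<Rightarrow> complex \<Rightarrow> complex" where
  "fock_kernel \<alpha> z u = exp (of_real \<alpha> * cnj z * u - of_real (\<alpha> / 2 * (norm z)\<^sup>2))"

lemma norm_diff_square_complex:
  "(norm (u - w))\<^sup>2 = (norm u)\<^sup>2 + (norm w)\<^sup>2 - 2 * Re (cnj w * u)"
  unfolding cmod_power2 by (simp add: power2_eq_square algebra_simps)

lemma norm_fock_kernel:
  "norm (fock_kernel \<alpha> z u) * exp (- (\<alpha> / 2) * (norm u)\<^sup>2) = exp (- (\<alpha> / 2) * (norm (u - z))\<^sup>2)"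
proof -
  have "Re (of_real \<alpha> * cnj z * u) = \<alpha> * Re (cnj z * u)" by (simp add: algebra_simps)
  thus ?thesis
    unfolding fock_kernel_def norm_exp_eq_Re exp_add[symmetric] norm_diff_square_complex
    by (simp add: algebra_simps)
qed

lemma norm_fock_kernel_le:
  assumes "0 < \<alpha>"
  shows "norm (fock_kernel \<alpha> z u) * exp (- (\<alpha> / 2) * (norm u)\<^sup>2) \<le> 1"
  unfolding norm_fock_kernel using assms by simp

lemma holomorphic_fock_kernel: "fock_kernel \<alpha> z holomorphic_on UNIV"
  unfolding fock_kernel_def[abs_def] by (intro holomorphic_intros)

section \<open>Decay of quotient norms and of functions with a high-order zero\<close>

lemma quotient_norm_fock_kernel_le:
  assumes \<alpha>: "0 < \<alpha>" and r: "0 < r" "real n = \<alpha> * r\<^sup>2" and far: "r \<le> norm (z - w)"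
  shows "quotient_norm \<alpha> w n (fock_kernel \<alpha> z) \<le> ennreal (exp (- (\<alpha> / 2) * (norm (z - w) - r)\<^sup>2))"
proof -
  define s where "s = norm (z - w)"
  define v where "v u = of_real \<alpha> * cnj (z - w) * (u - w)" for u
  define S where "S v = (\<Sum>k<n. v ^ k / fact k)" for v :: complex
  \<comment> \<open>The first two factors form a constant multiple of the kernel at
    \<open>w\<close>, so \<open>h\<close> is a Taylor truncation in coordinates centred at
    \<open>w\<close>. The difference \<open>g\<close> from the kernel has a zero of order
    \<open>n\<close> there, and the quotient norm is at most the norm of \<open>h\<close>.\<close>
  define h where "h u = fock_kernel \<alpha> z u * exp (- v u) * S (v u)" for u
  define g where "g u = fock_kernel \<alpha> z u - h u" for u
  have s0: "0 < s" "r \<le> s" using r far by (auto simp: s_def)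
  have nv: "norm (v u) = \<alpha> * s * norm (u - w)" for u
    using \<alpha> by (simp add: v_def norm_mult s_def flip: complex_cnj_diff)
  have h_le: "norm (h u) * exp (- (\<alpha> / 2) * (norm u)\<^sup>2) \<le> exp (- (\<alpha> / 2) * (s - r)\<^sup>2)" for u
  proof -
    define y where "y = norm (u - w)"
    define A where "A = Re (cnj (z - w) * (u - w))"
    have dist_eq: "(norm (u - z))\<^sup>2 = y\<^sup>2 + s\<^sup>2 - 2 * A"
      using norm_diff_square_complex[of "u - w" "z - w"] by (simp add: y_def s_def A_def)
    have Re_eq: "Re (v u) = \<alpha> * A"
      by (simp add: v_def A_def algebra_simps)
    have eq: "- (\<alpha> / 2) * (norm (u - z))\<^sup>2 - Re (v u) = - (\<alpha> / 2) * (y\<^sup>2 + s\<^sup>2)"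
      unfolding dist_eq Re_eq by (simp add: algebra_simps)
    have "norm (h u) * exp (- (\<alpha> / 2) * (norm u)\<^sup>2)
        = (norm (fock_kernel \<alpha> z u) * exp (- (\<alpha> / 2) * (norm u)\<^sup>2)) * exp (- Re (v u)) * norm (S (v u))"
      by (simp add: h_def norm_mult norm_exp_eq_Re)
    also have "\<dots> = exp (- (\<alpha> / 2) * (y\<^sup>2 + s\<^sup>2)) * norm (S (v u))"
      unfolding norm_fock_kernel eq[symmetric] by (simp only: exp_diff exp_minus divide_inverse)
    \<comment> \<open>The parameter \<open>t = r / s\<close> turns the exponent into a quadratic in
      \<open>y\<close> that peaks at \<open>y = r\<close>, whatever \<open>u\<close> is.\<close>
    also have "\<dots> \<le> exp (- (\<alpha> / 2) * (y\<^sup>2 + s\<^sup>2)) * (exp (norm (v u) * (r / s)) / (r / s) ^ n)"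
      unfolding S_def using r s0 by (intro mult_left_mono norm_truncated_exp_le) auto
    also have "\<dots> = (s / r) ^ n * exp (- (\<alpha> / 2) * (y\<^sup>2 + s\<^sup>2) + \<alpha> * y * r)"
    proof -
      have "norm (v u) * (r / s) = \<alpha> * y * r" using s0 by (simp add: nv y_def)
      thus ?thesis by (simp only: exp_add power_divide) (simp add: mult_ac)
    qed
    also have "\<dots> \<le> (s / r) ^ n * exp (\<alpha> / 2 * (r\<^sup>2 - s\<^sup>2))"
    proof -
      have "0 \<le> \<alpha> / 2 * (y - r)\<^sup>2" using \<alpha> by simp
      hence "- (\<alpha> / 2) * (y\<^sup>2 + s\<^sup>2) + \<alpha> * y * r \<le> \<alpha> / 2 * (r\<^sup>2 - s\<^sup>2)"
        by (simp add: power2_eq_square algebra_simps)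
      thus ?thesis using s0 r by (intro mult_left_mono) auto
    qed
    also have "\<dots> \<le> exp (- (\<alpha> / 2) * (s - r)\<^sup>2)" using weighted_power_le r s0 by simp
    finally show ?thesis .
  qed
  obtain q where q: "q holomorphic_on UNIV" "\<And>v. exp v - S v = v ^ n * q v"
    using exp_remainder_factor[of n] unfolding S_def by blast
  define p where "p u = fock_kernel \<alpha> z u * exp (- v u) * (of_real \<alpha> * cnj (z - w)) ^ n * q (v u)" for u
  have hol_v: "v holomorphic_on UNIV" unfolding v_def[abs_def] by (intro holomorphic_intros)
  have "(q \<circ> v) holomorphic_on UNIV"
    by (rule holomorphic_on_compose_gen[OF hol_v q(1)]) auto
  hence "p holomorphic_on UNIV"
    unfolding p_def[abs_def] o_def
    by (intro holomorphic_intros holomorphic_fock_kernel hol_v)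
  moreover have "g u = (u - w) ^ n * p u" for u
  proof -
    have "g u = fock_kernel \<alpha> z u * exp (- v u) * (exp (v u) - S (v u))"
      by (simp add: g_def h_def algebra_simps exp_minus)
    also have "\<dots> = (u - w) ^ n * p u"
      by (simp add: q p_def v_def power_mult_distrib mult_ac)
    finally show ?thesis .
  qed
  moreover have "norm (g u) * exp (- (\<alpha> / 2) * (norm u)\<^sup>2) \<le> 2" for u
  proof -
    have "norm (g u) * exp (- (\<alpha> / 2) * (norm u)\<^sup>2) \<le>
        (norm (fock_kernel \<alpha> z u) + norm (h u)) * exp (- (\<alpha> / 2) * (norm u)\<^sup>2)"
      unfolding g_def by (intro mult_right_mono norm_triangle_ineq4) auto
    also have "\<dots> \<le> 1 + exp (- (\<alpha> / 2) * (s - r)\<^sup>2)"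
      unfolding distrib_right by (intro add_mono norm_fock_kernel_le \<alpha> h_le)
    also have "\<dots> \<le> 2" using \<alpha> by simp
    finally show ?thesis .
  qed
  ultimately have "g \<in> vanishing_space \<alpha> w n" by (rule vanishing_spaceI)
  hence "quotient_norm \<alpha> w n (fock_kernel \<alpha> z) \<le> fock_norm \<alpha> (\<lambda>u. fock_kernel \<alpha> z u - g u)"
    unfolding quotient_norm_def by (rule INF_lower)
  also have "(\<lambda>u. fock_kernel \<alpha> z u - g u) = h" by (simp add: g_def)
  also have "fock_norm \<alpha> h \<le> ennreal (exp (- (\<alpha> / 2) * (s - r)\<^sup>2))" by (intro fock_norm_le h_le)
  finally show ?thesis by (simp add: s_def)
qed

text \<open>After the zero is divided out, the maximum principle carries the bound from the circle
  of radius \<open>r\<close> to its interior; restoring the factor \<open>(z - w) ^ n\<close> gives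
  the decay.\<close>

lemma vanishing_space_pointwise_bound:
  assumes f: "f \<in> vanishing_space \<alpha> w n" and r: "0 < r" "real n = \<alpha> * r\<^sup>2" and near: "norm (z - w) \<le> r"
    and M: "\<And>u. norm (f u) * exp (- (\<alpha> / 2) * (norm u)\<^sup>2) \<le> M"
  shows "norm (f z) * exp (- (\<alpha> / 2) * (norm z)\<^sup>2) \<le> M * exp (- (\<alpha> / 2) * (norm (z - w) - r)\<^sup>2)"
proof -
  have M0: "0 \<le> M" using M[of 0] by (rule order_trans[rotated]) simp
  obtain q where q: "q holomorphic_on UNIV" "\<And>u. f u = (u - w) ^ n * q u"
    using f entire_factor_zero[of f n w] unfolding vanishing_space_def fock_space_def by blast
  \<comment> \<open>The exponential recentres the weight at \<open>w\<close>. It becomes constant on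
    the circle, so the bound \<open>M\<close> for \<open>f\<close> there is a bound \<open>B\<close>
    for \<open>G\<close>.\<close>
  define G where "G u = q u * exp (of_real (\<alpha> / 2 * (norm w)\<^sup>2) - of_real \<alpha> * cnj w * u)" for u
  have hol: "G holomorphic_on UNIV" unfolding G_def[abs_def] by (intro holomorphic_intros q)
  have f_eq: "norm (f u) * exp (- (\<alpha> / 2) * (norm u)\<^sup>2)
      = norm (G u) * (norm (u - w) ^ n * exp (- (\<alpha> / 2) * (norm (u - w))\<^sup>2))" for u
  proof -
    have "Re (of_real \<alpha> * cnj w * u) = \<alpha> * Re (cnj w * u)" by (simp add: algebra_simps)
    hence "exp (- (\<alpha> / 2) * (norm u)\<^sup>2) =
        norm (exp (of_real (\<alpha> / 2 * (norm w)\<^sup>2) - of_real \<alpha> * cnj w * u))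
          * exp (- (\<alpha> / 2) * (norm (u - w))\<^sup>2)"
      unfolding norm_exp_eq_Re exp_add[symmetric] norm_diff_square_complex by (simp add: algebra_simps)
    thus ?thesis by (simp add: G_def q norm_mult norm_power mult_ac)
  qed
  define B where "B = M * exp (\<alpha> / 2 * r\<^sup>2) / r ^ n"
  have "norm (G z) \<le> B"
  proof (rule maximum_modulus_frontier[of G "cball w r"])
    fix u assume "u \<in> frontier (cball w r)"
    hence u: "norm (u - w) = r" using r by (simp add: dist_norm norm_minus_commute)
    have "norm (G u) * (r ^ n * exp (- (\<alpha> / 2) * r\<^sup>2)) \<le> M" using M[of u] f_eq[of u] u by simp
    thus "norm (G u) \<le> B" using r by (simp add: B_def field_simps exp_minus)
  qed (use near in \<open>auto simp: dist_norm norm_minus_commute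
      intro: holomorphic_on_subset[OF hol] holomorphic_on_imp_continuous_on\<close>)
  define s where "s = norm (z - w)"
  have "norm (f z) * exp (- (\<alpha> / 2) * (norm z)\<^sup>2) \<le> B * (s ^ n * exp (- (\<alpha> / 2) * s\<^sup>2))"
    unfolding f_eq s_def by (intro mult_right_mono \<open>norm (G z) \<le> B\<close>) auto
  also have "\<dots> = M * ((s / r) ^ n * exp (\<alpha> / 2 * (r\<^sup>2 - s\<^sup>2)))"
  proof -
    have "exp (\<alpha> / 2 * (r\<^sup>2 - s\<^sup>2)) = exp (\<alpha> / 2 * r\<^sup>2) * exp (- (\<alpha> / 2) * s\<^sup>2)"
      unfolding exp_add[symmetric] by (simp add: algebra_simps)
    thus ?thesis unfolding B_def power_divide
      by (simp only: times_divide_eq_left times_divide_eq_right mult_ac)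
  qed
  also have "\<dots> \<le> M * exp (- (\<alpha> / 2) * (s - r)\<^sup>2)"
    using M0 r by (intro mult_left_mono weighted_power_le) (auto simp: s_def)
  finally show ?thesis by (simp add: s_def)
qed

section \<open>Covering from sampling, separation from interpolation\<close>

text \<open>An interpolant has the same quotient norms as its data, here at most 1, so sampling
  bounds its norm by \<open>L\<close> uniformly in \<open>v\<close> and \<open>z\<close>.\<close>

lemma interpolating_sampling_extends_kernel:
  assumes \<alpha>: "0 < \<alpha>" and L: "0 \<le> L"
    and sam: "\<And>f. f \<in> fock_space \<alpha> \<Longrightarrow>
      fock_norm \<alpha> f \<le> ennreal L * (SUP w\<in>\<Lambda>. quotient_norm \<alpha> w (m w) f)"
    and int: "interpolating \<alpha> \<Lambda> m" and v: "v \<in> \<Lambda>"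
  obtains f where "\<And>u. norm (f u) * exp (- (\<alpha> / 2) * (norm u)\<^sup>2) \<le> L"
    "(\<lambda>u. f u - fock_kernel \<alpha> z u) \<in> vanishing_space \<alpha> v (m v)"
    "\<And>w. w \<in> \<Lambda> \<Longrightarrow> w \<noteq> v \<Longrightarrow> f \<in> vanishing_space \<alpha> w (m w)"
proof -
  define F where "F w = (if w = v then fock_kernel \<alpha> z else (\<lambda>u. 0))" for w
  have F: "F w \<in> fock_space \<alpha>" "fock_norm \<alpha> (F w) \<le> 1" for w
    using fock_spaceI[OF holomorphic_fock_kernel[of \<alpha> z] norm_fock_kernel_le[OF \<alpha>]]
      fock_norm_le[of "fock_kernel \<alpha> z" \<alpha> 1, OF norm_fock_kernel_le[OF \<alpha>]]
      fock_norm_le[of "\<lambda>u. 0" \<alpha> 1] fock_spaceI[of "\<lambda>u. 0" \<alpha> 1]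
    by (auto simp: F_def)
  have "quotient_norm \<alpha> w (m w) (F w) \<le> 1" for w
    unfolding quotient_norm_def
    by (rule INF_lower2[OF zero_in_vanishing_space]) (use F in simp)
  hence "(SUP w\<in>\<Lambda>. quotient_norm \<alpha> w (m w) (F w)) \<le> 1" by (intro SUP_least)
  hence "(SUP w\<in>\<Lambda>. quotient_norm \<alpha> w (m w) (F w)) < \<infinity>" by (rule le_less_trans) simp
  then obtain f where f: "f \<in> fock_space \<alpha>"
      "\<And>w. w \<in> \<Lambda> \<Longrightarrow> (\<lambda>u. f u - F w u) \<in> vanishing_space \<alpha> w (m w)"
    using int F unfolding interpolating_def by meson
  have "quotient_norm \<alpha> w (m w) f \<le> 1" if "w \<in> \<Lambda>" for w
    unfolding quotient_norm_def
    by (rule INF_lower2[OF f(2)[OF that]]) (use F in simp)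
  hence "(SUP w\<in>\<Lambda>. quotient_norm \<alpha> w (m w) f) \<le> 1" by (intro SUP_least)
  hence "ennreal L * (SUP w\<in>\<Lambda>. quotient_norm \<alpha> w (m w) f) \<le> ennreal L * 1"
    by (intro mult_left_mono) auto
  hence "fock_norm \<alpha> f \<le> ennreal L" using sam[OF f(1)] by simp
  thus thesis using that fock_normD[OF _ L] f(2) v by (force simp: F_def)
qed

theorem corollary1p7:
  fixes \<alpha> :: real and \<Lambda> :: "complex set" and m :: "complex \<Rightarrow> nat"
  assumes "\<alpha> > 0"
    and "divisor \<Lambda> m"
    and "multiplicities_tend_to_infinity \<Lambda> m"
  shows "\<not> (interpolating \<alpha> \<Lambda> m \<and> sampling \<alpha> \<Lambda> m)"
proof
  assume asm: "interpolating \<alpha> \<Lambda> m \<and> sampling \<alpha> \<Lambda> m"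
  then obtain L where L: "0 < L" and sam: "\<And>f. f \<in> fock_space \<alpha> \<Longrightarrow>
      fock_norm \<alpha> f \<le> ennreal L * (SUP w\<in>\<Lambda>. quotient_norm \<alpha> w (m w) f)"
    unfolding sampling_def by blast
  define \<rho> where "\<rho> w = sqrt (m w / \<alpha>)" for w
  \<comment> \<open>At distance \<open>C\<close> the Gaussian equals \<open>1 / (2 * L + 2)\<close>.
    Covering then needs \<open>L / (2 * L + 2) < 1\<close> and disjointness
    \<open>(2 * L + 1) / (2 * L + 2) < 1\<close>.\<close>
  define C where "C = sqrt (2 * ln (2 * L + 2) / \<alpha>)"
  have C0: "0 \<le> C" using L \<open>\<alpha> > 0\<close> by (simp add: C_def)
  have "\<alpha> / 2 * C\<^sup>2 = ln (2 * L + 2)" using L \<open>\<alpha> > 0\<close> by (simp add: C_def)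
  hence expC: "exp (- (\<alpha> / 2) * C\<^sup>2) = 1 / (2 * L + 2)"
    using L by (simp add: exp_minus field_simps)
  have \<rho>: "0 < \<rho> w" "real (m w) = \<alpha> * (\<rho> w)\<^sup>2" if "w \<in> \<Lambda>" for w
    using assms that by (force simp: \<rho>_def divisor_def)+
  have decay: "exp (- (\<alpha> / 2) * x\<^sup>2) \<le> 1 / (2 * L + 2)" if "C \<le> \<bar>x\<bar>" for x
  proof -
    have "C\<^sup>2 \<le> x\<^sup>2" using power_mono[OF that C0, of 2] by simp
    hence "exp (- (\<alpha> / 2) * x\<^sup>2) \<le> exp (- (\<alpha> / 2) * C\<^sup>2)" using assms(1) by simp
    thus ?thesis by (simp only: expC)
  qed
  have kernel_one: "norm (fock_kernel \<alpha> z z) * exp (- (\<alpha> / 2) * (norm z)\<^sup>2) = 1" for z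
    by (simp only: norm_fock_kernel) simp
  have cover: "\<exists>w\<in>\<Lambda>. dist z w \<le> \<rho> w + C" for z
  proof (rule ccontr)
    \<comment> \<open>The kernel at an uncovered \<open>z\<close> attains weighted modulus 1, but
      all its quotient norms are too small for the sampling inequality.\<close>
    assume "\<not> ?thesis"
    hence out: "\<rho> w + C < norm (z - w)" if "w \<in> \<Lambda>" for w using that by (auto simp: dist_norm)
    have "quotient_norm \<alpha> w (m w) (fock_kernel \<alpha> z) \<le> ennreal (1 / (2 * L + 2))" if "w \<in> \<Lambda>" for w
    proof -
      have "quotient_norm \<alpha> w (m w) (fock_kernel \<alpha> z) \<le>
          ennreal (exp (- (\<alpha> / 2) * (norm (z - w) - \<rho> w)\<^sup>2))"
        using out[OF that] C0 by (intro quotient_norm_fock_kernel_le \<rho> that assms) auto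
      also have "\<dots> \<le> ennreal (1 / (2 * L + 2))"
        using out[OF that] by (intro ennreal_leI decay) auto
      finally show ?thesis .
    qed
    hence "(SUP w\<in>\<Lambda>. quotient_norm \<alpha> w (m w) (fock_kernel \<alpha> z)) \<le> ennreal (1 / (2 * L + 2))"
      by (intro SUP_least)
    hence "ennreal L * (SUP w\<in>\<Lambda>. quotient_norm \<alpha> w (m w) (fock_kernel \<alpha> z))
        \<le> ennreal L * ennreal (1 / (2 * L + 2))" by (intro mult_left_mono) auto
    also have "\<dots> = ennreal (L / (2 * L + 2))" using L by (simp flip: ennreal_mult)
    finally have "fock_norm \<alpha> (fock_kernel \<alpha> z) \<le> ennreal (L / (2 * L + 2))"
      using sam[OF fock_spaceI[OF holomorphic_fock_kernel norm_fock_kernel_le[OF assms(1)]], of z]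
      by (meson order_trans)
    hence "1 \<le> L / (2 * L + 2)"
      using fock_normD[of \<alpha> "fock_kernel \<alpha> z" _ z] L unfolding kernel_one by auto
    thus False using L by (simp add: field_simps)
  qed
  \<comment> \<open>At a common point \<open>z\<close> of two shrunken discs, \<open>f\<close> minus
    the kernel is small because of \<open>v\<close> and \<open>f\<close> is small because of
    \<open>w\<close>, yet the kernel has weighted modulus 1.\<close>
  have disjoint: False
    if vw: "v \<in> \<Lambda>" "w \<in> \<Lambda>" "v \<noteq> w" and z: "norm (z - v) \<le> \<rho> v - C" "norm (z - w) \<le> \<rho> w - C"
    for v w z
  proof -
    define W where "W = exp (- (\<alpha> / 2) * (norm z)\<^sup>2)"
    obtain f where f: "\<And>u. norm (f u) * exp (- (\<alpha> / 2) * (norm u)\<^sup>2) \<le> L"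
        "(\<lambda>u. f u - fock_kernel \<alpha> z u) \<in> vanishing_space \<alpha> v (m v)"
        "f \<in> vanishing_space \<alpha> w (m w)"
      using interpolating_sampling_extends_kernel[OF assms(1) less_imp_le[OF L] sam, of v z] asm vw
      by metis
    have "norm (f u - fock_kernel \<alpha> z u) * exp (- (\<alpha> / 2) * (norm u)\<^sup>2) \<le> L + 1" for u
    proof -
      have "norm (f u - fock_kernel \<alpha> z u) * exp (- (\<alpha> / 2) * (norm u)\<^sup>2) \<le>
          (norm (f u) + norm (fock_kernel \<alpha> z u)) * exp (- (\<alpha> / 2) * (norm u)\<^sup>2)"
        by (intro mult_right_mono norm_triangle_ineq4) auto
      also have "\<dots> \<le> L + 1"
        unfolding distrib_right by (intro add_mono f norm_fock_kernel_le assms)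
      finally show ?thesis .
    qed
    hence "norm (f z - fock_kernel \<alpha> z z) * W \<le> (L + 1) * exp (- (\<alpha> / 2) * (norm (z - v) - \<rho> v)\<^sup>2)"
      unfolding W_def using z C0
      by (intro vanishing_space_pointwise_bound[OF f(2) \<rho>[OF vw(1)]]) auto
    also have "\<dots> \<le> (L + 1) * (1 / (2 * L + 2))"
      using L z by (intro mult_left_mono decay) auto
    finally have 1: "norm (f z - fock_kernel \<alpha> z z) * W \<le> (L + 1) / (2 * L + 2)" by simp
    have "norm (f z) * W \<le> L * exp (- (\<alpha> / 2) * (norm (z - w) - \<rho> w)\<^sup>2)"
      unfolding W_def using z C0
      by (intro vanishing_space_pointwise_bound[OF f(3) \<rho>[OF vw(2)]] f) auto
    also have "\<dots> \<le> L * (1 / (2 * L + 2))"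
      using L z by (intro mult_left_mono decay) auto
    finally have 2: "norm (f z) * W \<le> L / (2 * L + 2)" by simp
    have "1 = norm (fock_kernel \<alpha> z z) * W" using kernel_one by (simp add: W_def)
    also have "\<dots> \<le> (norm (f z) + norm (f z - fock_kernel \<alpha> z z)) * W"
      using norm_triangle_sub[of "fock_kernel \<alpha> z z" "f z"]
      by (intro mult_right_mono) (auto simp: W_def norm_minus_commute)
    also have "\<dots> \<le> L / (2 * L + 2) + (L + 1) / (2 * L + 2)"
      using 1 2 unfolding distrib_right by linarith
    also have "\<dots> < 1" using L by (simp flip: add_divide_distrib)
    finally show False by simp
  qed
  have sep: "\<rho> v + \<rho> w - 2 * C \<le> dist v w"
    if vw: "v \<in> \<Lambda>" "w \<in> \<Lambda>" "v \<noteq> w" "C \<le> \<rho> v" "C \<le> \<rho> w" for v w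
  proof (rule ccontr)
    assume overlap: "\<not> ?thesis"
    define d where "d = norm (w - v)"
    have d: "0 < d" "d < \<rho> v + \<rho> w - 2 * C"
      using overlap vw by (auto simp: d_def dist_norm norm_minus_commute)
    \<comment> \<open>The point \<open>z\<close> is on the segment from \<open>v\<close> to
      \<open>w\<close>, as far from \<open>v\<close> as its shrunken disc allows; the cap at 1
      covers the case where that disc contains \<open>w\<close>.\<close>
    define t where "t = min 1 ((\<rho> v - C) / d)"
    have t: "0 \<le> t" "t \<le> 1" using vw d by (auto simp: t_def)
    define z where "z = v + of_real t * (w - v)"
    have "z - w = of_real (1 - t) * (v - w)" by (simp add: z_def algebra_simps)
    hence zw: "norm (z - w) = (1 - t) * d" using t
      by (simp only: norm_mult norm_of_real) (simp add: d_def norm_minus_commute)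
    have zv: "norm (z - v) = t * d" using t by (simp add: z_def norm_mult d_def)
    have td: "t * d = min d (\<rho> v - C)" using d by (simp add: t_def min_def field_simps)
    hence "t * d \<le> \<rho> v - C" by simp
    moreover have "(1 - t) * d \<le> \<rho> w - C" using d vw td by (simp add: left_diff_distrib)
    ultimately show False using disjoint[OF vw(1-3), of z] zw zv by simp
  qed
  have grow: "\<exists>R. \<forall>w\<in>\<Lambda>. R < norm w \<longrightarrow> T \<le> \<rho> w" for T
  proof -
    obtain R where R: "\<And>w. w \<in> \<Lambda> \<Longrightarrow> R < norm w \<Longrightarrow> nat \<lceil>\<alpha> * T\<^sup>2\<rceil> < m w"
      using assms(3) unfolding multiplicities_tend_to_infinity_def by blast
    have "T \<le> \<rho> w" if "w \<in> \<Lambda>" "R < norm w" for w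
    proof -
      have "\<alpha> * T\<^sup>2 \<le> real (m w)" using R[OF that] by linarith
      hence "T\<^sup>2 \<le> m w / \<alpha>" using assms(1) by (simp add: field_simps)
      thus ?thesis unfolding \<rho>_def by (rule real_le_rsqrt)
    qed
    thus ?thesis by blast
  qed
  show False by (rule no_almost_tiling_by_growing_discs[OF C0 cover sep grow])
qed

end
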